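(* Let $J_3:\mathbb{N}\to\mathbb{N}$ be the Josephus function with reduction constant $3$, and let $\{n_e^{(i)}\}_{i\in\mathbb{N}}$ be the strictly increasing enumeration of all high extremal points of $J_3$ (so $n_e^{(1)}=1$). For each $i$ set $f_i:=n_e^{(i)}-J_3(n_e^{(i)})\in\{0,1\}$ and $r_i:=n_e^{(i)} \bmod 2$. Then: (i) if $f_i=1$ and $r_i=0$, then $n_e^{(i+1)}=\frac{3n_e^{(i)}+2}{2}$ and $f_{i+1}=0$; (ii) if $f_i=1$ and $r_i=1$, then $n_e^{(i+1)}=\frac{3n_e^{(i)}+1}{2}$ and $f_{i+1}=1$; (iii) if $f_i=0$ and $r_i=0$, then $n_e^{(i+1)}=\frac{3n_e^{(i)}}{2}$ and $f_{i+1}=1$; (iv) if $f_i=0$ and $r_i=1$, then $n_e^{(i+1)}=\frac{3n_e^{(i)}+1}{2}$ and $f_{i+1}=0$.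
   Context: The Josephus function $J_3$: for $n\in\mathbb{N}=\{1,2,\dots\}$, place $n$ people numbered $1,\dots,n$ clockwise in a circle; starting the count at person $1$ and proceeding clockwise, count people and eliminate every third person (the first eliminated is person $3$), the circle closing ranks after each elimination, until one person remains; $J_3(n)\in\{1,\dots,n\}$ is the original number of the survivor. Equivalently $J_3(1)=1$ and $J_3(n)=((J_3(n-1)+2)\bmod n)+1$ for $n\ge 2$. A positive integer $n$ is a high extremal point of $J_3$ if $J_3(n)\in\{n-1,n\}$; it is a fixed point if $J_3(n)=n$, and a pure high extremal point if $J_3(n)=n-1$. *)

theory Defs
  imports Complex_Main "HOL-Library.Infinite_Set"
begin

text \<open>The list is the circle read clockwise from the person at whom the count starts. Rotating by
  \<open>k - 1\<close> brings the \<open>k\<close>-th counted person to the front; he is removed and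
  the count resumes with his successor.\<close>

function josephus_survivor :: "nat \<Rightarrow> 'a list \<Rightarrow> 'a" where
  "josephus_survivor k xs =
     (if length xs \<le> 1 then hd xs else josephus_survivor k (tl (rotate (k - 1) xs)))"
  by auto
termination by (relation "measure (\<lambda>(k, xs). length xs)") auto

declare josephus_survivor.simps [simp del]

definition josephus :: "nat \<Rightarrow> nat \<Rightarrow> nat" where
  "josephus k n = josephus_survivor k [1..<n + 1]"

abbreviation J3 :: "nat \<Rightarrow> nat" where
  "J3 \<equiv> josephus 3"

definition high_extremal :: "nat \<Rightarrow> bool" where
  "high_extremal n \<longleftrightarrow> n \<ge> 1 \<and> J3 n \<in> {n - 1, n}"

text \<open>The sequences are indexed from 1, whereas \<^const>\<open>enumerate\<close> counts from 0.
  Lemma \<open>infinite_high_extremal\<close> below ensures that the enumeration never runs out.\<close>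

definition n_e :: "nat \<Rightarrow> nat" where
  "n_e i = enumerate {n. high_extremal n} (i - 1)"

definition f_e :: "nat \<Rightarrow> int" where
  "f_e i = int (n_e i) - int (J3 (n_e i))"

definition r_e :: "nat \<Rightarrow> nat" where
  "r_e i = n_e i mod 2"

lemma josephus_survivor_map:
  "xs \<noteq> [] \<Longrightarrow> josephus_survivor k (map g xs) = g (josephus_survivor k xs)"
proof (induction "length xs" arbitrary: xs rule: less_induct)
  case less
  show ?case
  proof (cases "length xs \<le> 1")
    case True
    with less.prems show ?thesis by (simp add: josephus_survivor.simps hd_map)
  next
    case False
    let ?ys = "tl (rotate (k - 1) xs)"
    from False have "length ?ys < length xs" "?ys \<noteq> []"
      by (auto simp flip: length_greater_0_conv)
    from less.hyps[OF this] False show ?thesis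
      by (simp add: josephus_survivor.simps[of k xs] josephus_survivor.simps[of k "map g xs"]
          rotate_map map_tl)
  qed
qed

lemma josephus_1: "josephus k 1 = 1"
  by (simp add: josephus_def josephus_survivor.simps)

lemma josephus_rec:
  assumes "k \<ge> 1" "n \<ge> 2"
  shows "josephus k n = (josephus k (n - 1) + (k - 1)) mod n + 1"
proof -
  have "tl (rotate (k - 1) [1..<n + 1]) = map (\<lambda>m. (m + (k - 1)) mod n + 1) [1..<n - 1 + 1]"
    using assms
    by (intro nth_equalityI) (auto simp: nth_tl nth_rotate add_ac simp del: upt_Suc)
  then have "josephus k n = josephus_survivor k (map (\<lambda>m. (m + (k - 1)) mod n + 1) [1..<n - 1 + 1])"
    unfolding josephus_def using assms
    by (subst josephus_survivor.simps) (simp del: upt_Suc)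
  then show ?thesis
    using assms by (simp add: josephus_survivor_map josephus_def del: upt_Suc)
qed

lemma J3_rec: "n \<ge> 2 \<Longrightarrow> J3 n = (J3 (n - 1) + 2) mod n + 1"
  using josephus_rec[of 3 n] by simp

lemma J3_bounds:
  assumes "n \<ge> 1"
  shows "1 \<le> J3 n" "J3 n \<le> n"
proof -
  have "1 \<le> J3 n \<and> J3 n \<le> n"
  proof (cases "n = 1")
    case True
    then show ?thesis by (metis josephus_1 order_refl)
  next
    case False
    then have "n \<ge> 2" using assms by simp
    with J3_rec[OF this] show ?thesis by (simp add: Suc_le_eq)
  qed
  then show "1 \<le> J3 n" "J3 n \<le> n" by auto
qed

lemma infinite_high_extremal: "infinite {n. high_extremal n}"
proof
  assume "finite {n. high_extremal n}"
  then obtain N where N: "\<And>n. high_extremal n \<Longrightarrow> n < N"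
    by (auto simp: finite_nat_set_iff_bounded)
  define M where "M = N + 1"
  have *: "J3 (M + d) \<ge> J3 M + 3 * d" for d
  proof (induction d)
    case (Suc d)
    have "\<not> high_extremal (M + d)" using N[of "M + d"] by (auto simp: M_def)
    moreover have "J3 (M + d) \<le> M + d" by (rule J3_bounds) (simp add: M_def)
    ultimately have "J3 (M + d) + 2 < M + d + 1" by (auto simp: high_extremal_def M_def)
    then have "J3 (M + d + 1) = J3 (M + d) + 3"
      using J3_rec[of "M + d + 1"] by (simp add: M_def)
    with Suc show ?case by simp
  qed simp
  have "J3 (M + M) \<le> M + M" by (rule J3_bounds) (simp add: M_def)
  with *[of M] show False by (simp add: M_def)
qed

lemma strict_mono_on_n_e: "strict_mono_on {1..} n_e"
  by (auto simp: strict_mono_on_def n_e_def intro!: enumerate_mono infinite_high_extremal)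

lemma n_e_image: "n_e ` {1..} = {n. high_extremal n}"
proof -
  have "n_e ` {1..} = enumerate {n. high_extremal n} ` ((\<lambda>i. i - 1) ` {1..})"
    by (simp add: image_image n_e_def)
  also have "(\<lambda>i. i - 1) ` {1..} = (UNIV :: nat set)"
    by (auto intro!: image_eqI[where x = "Suc _"])
  finally show ?thesis by (simp add: range_enumerate infinite_high_extremal)
qed

lemma n_e_1: "n_e 1 = 1"
proof -
  have "(LEAST n. high_extremal n) = 1"
    using josephus_1[of 3] by (intro Least_equality) (auto simp: high_extremal_def)
  then show ?thesis by (simp add: n_e_def enumerate_0)
qed

lemma f_e_range:
  assumes "i \<ge> 1"
  shows "f_e i \<in> {0, 1}"
proof -
  have "high_extremal (n_e i)" using n_e_image assms by auto
  then show ?thesis by (auto simp: f_e_def high_extremal_def)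
qed

end

theory Submission
  imports Defs
begin

text \<open>Let \<open>n\<close> be high extremal and \<open>f = n - J3 n\<close>. The step from \<open>n\<close> to \<open>n + 1\<close> wraps around and
  gives \<open>J3 (n + 1) = 2 - f\<close>. From then on \<open>J3\<close> gains 3 at each step, so the gap \<open>m - J3 m\<close>, which
  is \<open>n - 1 + f\<close> at \<open>m = n + 1\<close>, shrinks by 2 at each step until it first lies in \<open>{0, 1}\<close>. This
  happens after \<open>(n - 1 + f) div 2\<close> steps, and the remaining gap is \<open>(n - 1 + f) mod 2\<close>.\<close>

text \<open>The bound on \<open>d\<close> says \<open>J3 m + 3 * d \<le> m + d\<close>: while the
  claimed value does not exceed its argument, the modulus in the recurrence has no effect.\<close>

lemma J3_add:
  assumes "m \<ge> 1" "J3 m + 2 * d \<le> m"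
  shows "J3 (m + d) = J3 m + 3 * d"
  using assms(2)
proof (induction d)
  case (Suc d)
  then have "J3 (m + d) = J3 m + 3 * d" by simp
  with Suc.prems assms(1) show ?case
    using J3_rec[of "m + d + 1"] by simp
qed simp

text \<open>\<open>J3 n + 2\<close> is \<open>n + 1\<close> or \<open>n + 2\<close>, so reduction
  modulo \<open>n + 1\<close> leaves 0 or 1. The additive form avoids truncated subtraction.\<close>

lemma J3_Suc_high_extremal:
  assumes "high_extremal n"
  shows "J3 (n + 1) + n = J3 n + 2"
proof -
  have n: "n \<ge> 1" and "J3 n = n - 1 \<or> J3 n = n"
    using assms by (auto simp: high_extremal_def)
  then show ?thesis
  proof (elim disjE)
    assume "J3 n = n"
    moreover from this have "J3 (n + 1) = (n + 1 + 1) mod (n + 1) + 1"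
      using J3_rec[of "n + 1"] n by simp
    moreover have "(n + 1 + 1) mod (n + 1) = 1"
      using n by (subst mod_add_self1) simp
    ultimately show ?thesis by simp
  next
    assume "J3 n = n - 1"
    then show ?thesis
      using J3_rec[of "n + 1"] n by simp
  qed
qed

lemma next_high_extremal:
  assumes "high_extremal n"
  defines "g \<equiv> 2 * n - J3 n - 1"
  defines "m \<equiv> n + 1 + g div 2"
  shows "(LEAST k. high_extremal k \<and> n < k) = m" and "m - J3 m = g mod 2"
proof -
  have n: "n \<ge> 1" "J3 n \<le> n"
    using assms(1) J3_bounds by (auto simp: high_extremal_def)
  \<comment> \<open>So \<open>g\<close> is the gap at \<open>n + 1\<close>.\<close>
  have g: "J3 (n + 1) + g = n + 1"
    using J3_Suc_high_extremal[OF assms(1)] n by (simp add: g_def)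
  have J: "J3 (n + 1 + d) = J3 (n + 1) + 3 * d" if "2 * d \<le> g" for d
    using that g by (intro J3_add) auto
  have Jm: "J3 m + g mod 2 = m"
    using J[of "g div 2"] g div_mult_mod_eq[of g 2] by (simp add: m_def)
  then show "m - J3 m = g mod 2" by simp
  have "g mod 2 = 0 \<or> g mod 2 = 1" by auto
  with Jm have "high_extremal m" by (auto simp: high_extremal_def m_def)
  moreover have "m \<le> k" if "high_extremal k" "n < k" for k
  proof (rule ccontr)
    assume "\<not> m \<le> k"
    define d where "d = k - (n + 1)"
    have k: "k = n + 1 + d" and d: "2 * d + 2 \<le> g"
      using \<open>n < k\<close> \<open>\<not> m \<le> k\<close> by (auto simp: d_def m_def)
    \<comment> \<open>The gap at \<open>k\<close> is \<open>g - 2 * d\<close>, still at least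
      2.\<close>
    have "J3 k + 2 \<le> k" using J[of d] g d k by simp
    with that(1) show False by (auto simp: high_extremal_def)
  qed
  ultimately show "(LEAST k. high_extremal k \<and> n < k) = m"
    by (intro Least_equality) (auto simp: m_def)
qed

lemma n_e_Suc:
  assumes "i \<ge> 1"
  shows "n_e (i + 1) = (LEAST k. high_extremal k \<and> n_e i < k)"
proof -
  \<comment> \<open>This undoes the index shift \<open>i - 1\<close> in \<open>n_e\<close>.\<close>
  obtain j where "i = Suc j" using assms by (cases i) auto
  then show ?thesis
    by (simp add: n_e_def enumerate_Suc''[OF infinite_high_extremal])
qed

theorem theorem1:
  fixes i :: nat
  assumes "i \<ge> 1"
  shows "(f_e i = 1 \<and> r_e i = 0 \<longrightarrow>
            real (n_e (i + 1)) = (3 * real (n_e i) + 2) / 2 \<and> f_e (i + 1) = 0) \<and>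
         (f_e i = 1 \<and> r_e i = 1 \<longrightarrow>
            real (n_e (i + 1)) = (3 * real (n_e i) + 1) / 2 \<and> f_e (i + 1) = 1) \<and>
         (f_e i = 0 \<and> r_e i = 0 \<longrightarrow>
            real (n_e (i + 1)) = 3 * real (n_e i) / 2 \<and> f_e (i + 1) = 1) \<and>
         (f_e i = 0 \<and> r_e i = 1 \<longrightarrow>
            real (n_e (i + 1)) = (3 * real (n_e i) + 1) / 2 \<and> f_e (i + 1) = 0)"
proof -
  define n where "n = n_e i"
  define n' where "n' = n_e (i + 1)"
  define g where "g = 2 * n - J3 n - 1"
  have ext: "high_extremal n" using n_e_image assms by (auto simp: n_def)
  have n: "n \<ge> 1" "J3 n \<le> n" "1 \<le> J3 n"
    using ext J3_bounds by (auto simp: high_extremal_def)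
  have n': "n' = n + 1 + g div 2" "n' - J3 n' = g mod 2"
    using next_high_extremal[OF ext] n_e_Suc[OF assms] by (simp_all add: n_def n'_def g_def)
  \<comment> \<open>Makes the truncated difference in \<open>n'(2)\<close> agree with the integer
    one in \<open>f_e\<close>.\<close>
  have "J3 n' \<le> n'" using n'(1) by (intro J3_bounds) simp
  then have f': "f_e (i + 1) = int (g mod 2)"
    using n'(2) by (simp add: f_e_def n'_def flip: of_nat_diff)
  have f: "f_e i = int n - int (J3 n)" by (simp add: f_e_def n_def)
  have r: "r_e i = n mod 2" by (simp add: r_e_def n_def)
  \<comment> \<open>In the four cases \<open>g\<close> is \<open>n\<close> or \<open>n - 1\<close>
    according to \<open>f_e i\<close>, and the parity of \<open>n\<close> then fixes that of
    \<open>g\<close>. Doubling keeps the equations in the naturals.\<close>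
  have 1: "2 * n' = 3 * n + 2 \<and> g mod 2 = 0" if "f_e i = 1" "r_e i = 0"
  proof -
    have "g = n" "even n" using that f r n by (auto simp: g_def)
    then show ?thesis using n'(1) by auto
  qed
  have 2: "2 * n' = 3 * n + 1 \<and> g mod 2 = 1" if "f_e i = 1" "r_e i = 1"
  proof -
    have "g = n" "odd n" using that f r n by (auto simp: g_def odd_iff_mod_2_eq_one)
    then show ?thesis using n'(1) by (auto elim!: oddE)
  qed
  have 3: "2 * n' = 3 * n \<and> g mod 2 = 1" if "f_e i = 0" "r_e i = 0"
  proof -
    have "n = g + 1" "odd g" using that f r n by (auto simp: g_def)
    then show ?thesis using n'(1) by (auto elim!: oddE)
  qed
  have 4: "2 * n' = 3 * n + 1 \<and> g mod 2 = 0" if "f_e i = 0" "r_e i = 1"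
  proof -
    have "n = g + 1" "even g" using that f r n by (auto simp: g_def odd_iff_mod_2_eq_one)
    then show ?thesis using n'(1) by auto
  qed
  have half: "real n' = x / 2" if "real (2 * n') = x" for x
    using that by simp
  show ?thesis
    unfolding f' n_def[symmetric] n'_def[symmetric]
    using 1 2 3 4 by (auto intro!: half)
qed

end
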